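(* The online AMA communication complexity of the $(m,2^{\sqrt m})$-Sparse INDEX problem is $\tilde\Omega(\sqrt m)$, i.e. $\Omega(\sqrt m)$ up to factors polylogarithmic in $m$.
   Context: $(m,n)$-Sparse INDEX: Alice holds $x\in\{0,1\}^n$ of Hamming weight at most $m$, Bob holds $\iota\in[n]$; the output is $x_\iota$. Here $n=2^{\sqrt m}$. Online MA communication for $F:X\times Y\to\{0,1\}$: (1) Alice and Merlin see $x$; (2) Merlin, using private randomness $r_M$, sends Alice $\mathfrak h_1(x,r_M)$; (3) Bob receives $y$; (4) Merlin sends Bob $\mathfrak h_2(x,y,r_M)$; (5) Alice sends Bob a message that may use a public random string $r_A$ unknown to Merlin, and Bob outputs a bit. Completeness: if $F(x,y)=1$ then, with the prescribed help, $\Pr[\text{output}=0]\le\delta_c$; soundness: if $F(x,y)=0$ then for all help messages $\Pr_{r_A}[\text{output}=1]\le\delta_s$; error is the least $\max\{\delta_s,\delta_c\}$. hcost $=1+\max(|\mathfrak h_1|+|\mathfrak h_2|)$; vcost is the maximum number of bits exchanged by Alice and Bob. An online AMA protocol is an online MA protocol preceded by public random coin tosses made before any input is revealed and visible to all parties (including Merlin); the number of these coin tosses is added to the vcost (the later public randomness $r_A$ is not counted). The online AMA communication complexity is the minimum of hcost $+$ vcost over online AMA protocols with error at most $1/3$. *)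

theory Defs
  imports "HOL-Probability.Probability" "HOL-Library.Landau_Symbols" "HOL-Library.Extended_Nat"
begin

definition coins :: "nat \<Rightarrow> bool list pmf" where
  "coins l = pmf_of_set {r. length r = l}"

text \<open>
  A communication problem is a function \<open>F\<close> together with its domain \<open>X \<times> Y\<close>. Only Alice's
  message is counted as verifier communication, since Bob never speaks.

  The field \<open>alice P x h1 rA\<close> is the message Alice sends to Bob when she has received \<open>h1\<close> from
  Merlin; Bob does not see \<open>h1\<close>. The public string \<open>rA\<close> is seen by Alice and Bob but not by
  Merlin, so it is an argument of neither help function.
\<close>

record ('x, 'y) online_MA =
  merlin_coins :: nat
  public_coins :: nat
  help1 :: "'x \<Rightarrow> bool list \<Rightarrow> bool list"
  help2 :: "'x \<Rightarrow> 'y \<Rightarrow> bool list \<Rightarrow> bool list"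
  alice :: "'x \<Rightarrow> bool list \<Rightarrow> bool list \<Rightarrow> bool list"
  bob :: "'y \<Rightarrow> bool list \<Rightarrow> bool list \<Rightarrow> bool list \<Rightarrow> bool"

definition MA_output :: "('x, 'y) online_MA \<Rightarrow> 'x \<Rightarrow> 'y \<Rightarrow> bool list \<Rightarrow> bool list \<Rightarrow> bool pmf" where
  "MA_output P x y h1 h2 =
     map_pmf (\<lambda>rA. bob P y h2 rA (alice P x h1 rA)) (coins (public_coins P))"

definition MA_honest_output :: "('x, 'y) online_MA \<Rightarrow> 'x \<Rightarrow> 'y \<Rightarrow> bool pmf" where
  "MA_honest_output P x y =
     bind_pmf (coins (merlin_coins P)) (\<lambda>rM. MA_output P x y (help1 P x rM) (help2 P x y rM))"

definition MA_hcost :: "'x set \<Rightarrow> 'y set \<Rightarrow> ('x, 'y) online_MA \<Rightarrow> enat" where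
  "MA_hcost X Y P =
     1 + (SUP (x, y, rM) \<in> X \<times> Y \<times> set_pmf (coins (merlin_coins P)).
            enat (length (help1 P x rM) + length (help2 P x y rM)))"

text \<open>The maximum below is over all executions, including those with dishonest help.\<close>

definition MA_vcost :: "'x set \<Rightarrow> ('x, 'y) online_MA \<Rightarrow> enat" where
  "MA_vcost X P =
     (SUP (x, h1, rA) \<in> X \<times> UNIV \<times> set_pmf (coins (public_coins P)).
        enat (length (alice P x h1 rA)))"

text \<open>
  After the initial tosses \<open>c\<close>, which everybody sees, the online MA protocol \<open>stage A c\<close> is run.
\<close>

record ('x, 'y) online_AMA =
  initial_coins :: nat
  stage :: "bool list \<Rightarrow> ('x, 'y) online_MA"

definition AMA_honest_output :: "('x, 'y) online_AMA \<Rightarrow> 'x \<Rightarrow> 'y \<Rightarrow> bool pmf" where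
  "AMA_honest_output A x y =
     bind_pmf (coins (initial_coins A)) (\<lambda>c. MA_honest_output (stage A c) x y)"

text \<open>Since Merlin sees the initial tosses, dishonest help messages are functions of them.\<close>

definition AMA_output ::
  "('x, 'y) online_AMA \<Rightarrow> 'x \<Rightarrow> 'y \<Rightarrow> (bool list \<Rightarrow> bool list) \<Rightarrow> (bool list \<Rightarrow> bool list) \<Rightarrow> bool pmf"
where
  "AMA_output A x y h1 h2 =
     bind_pmf (coins (initial_coins A)) (\<lambda>c. MA_output (stage A c) x y (h1 c) (h2 c))"

definition AMA_complete ::
  "'x set \<Rightarrow> 'y set \<Rightarrow> ('x \<Rightarrow> 'y \<Rightarrow> bool) \<Rightarrow> ('x, 'y) online_AMA \<Rightarrow> real \<Rightarrow> bool" where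
  "AMA_complete X Y F A \<delta> \<longleftrightarrow>
     (\<forall>x\<in>X. \<forall>y\<in>Y. F x y \<longrightarrow> pmf (AMA_honest_output A x y) False \<le> \<delta>)"

definition AMA_sound ::
  "'x set \<Rightarrow> 'y set \<Rightarrow> ('x \<Rightarrow> 'y \<Rightarrow> bool) \<Rightarrow> ('x, 'y) online_AMA \<Rightarrow> real \<Rightarrow> bool" where
  "AMA_sound X Y F A \<delta> \<longleftrightarrow>
     (\<forall>x\<in>X. \<forall>y\<in>Y. \<not> F x y \<longrightarrow> (\<forall>h1 h2. pmf (AMA_output A x y h1 h2) True \<le> \<delta>))"

definition AMA_error_le ::
  "'x set \<Rightarrow> 'y set \<Rightarrow> ('x \<Rightarrow> 'y \<Rightarrow> bool) \<Rightarrow> ('x, 'y) online_AMA \<Rightarrow> real \<Rightarrow> bool" where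
  "AMA_error_le X Y F A \<epsilon> \<longleftrightarrow>
     (\<exists>\<delta>c \<delta>s. AMA_complete X Y F A \<delta>c \<and> AMA_sound X Y F A \<delta>s \<and> max \<delta>s \<delta>c \<le> \<epsilon>)"

definition AMA_hcost :: "'x set \<Rightarrow> 'y set \<Rightarrow> ('x, 'y) online_AMA \<Rightarrow> enat" where
  "AMA_hcost X Y A = (SUP c \<in> set_pmf (coins (initial_coins A)). MA_hcost X Y (stage A c))"

definition AMA_vcost :: "'x set \<Rightarrow> ('x, 'y) online_AMA \<Rightarrow> enat" where
  "AMA_vcost X A =
     enat (initial_coins A) + (SUP c \<in> set_pmf (coins (initial_coins A)). MA_vcost X (stage A c))"

definition AMA_complexity :: "'x set \<Rightarrow> 'y set \<Rightarrow> ('x \<Rightarrow> 'y \<Rightarrow> bool) \<Rightarrow> nat" where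
  "AMA_complexity X Y F =
     (LEAST k. \<exists>A. AMA_error_le X Y F A (1/3) \<and> AMA_hcost X Y A + AMA_vcost X A = enat k)"

text \<open>Positions are counted from \<open>0\<close>, so that \<open>[n]\<close> is \<open>{..<n}\<close>.\<close>

definition sparse_inputs :: "nat \<Rightarrow> nat \<Rightarrow> bool list set" where
  "sparse_inputs m n = {x. length x = n \<and> count_list x True \<le> m}"

definition sparse_index_complexity :: "nat \<Rightarrow> nat \<Rightarrow> nat" where
  "sparse_index_complexity m n = AMA_complexity (sparse_inputs m n) {..<n} (\<lambda>x i. x ! i)"

text \<open>The minimum in the complexity is attained: without help, Alice can send her whole input.\<close>

lemma sparse_index_complexity_attained:
  obtains A where "AMA_error_le (sparse_inputs m n) {..<n} (\<lambda>x i. x ! i) A (1/3)"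
    and "AMA_hcost (sparse_inputs m n) {..<n} A + AMA_vcost (sparse_inputs m n) A
           = enat (sparse_index_complexity m n)"
proof -
  let ?X = "sparse_inputs m n"
  define P :: "(bool list, nat) online_MA" where
    "P = \<lparr>merlin_coins = 0, public_coins = 0, help1 = \<lambda>_ _. [], help2 = \<lambda>_ _ _. [],
          alice = \<lambda>x _ _. x, bob = \<lambda>i _ _ a. a ! i\<rparr>"
  define A where "A = \<lparr>initial_coins = 0, stage = \<lambda>_. P\<rparr>"
  have c0: "coins 0 = return_pmf []"
    by (simp add: coins_def pmf_of_set_singleton)
  have "AMA_error_le ?X {..<n} (\<lambda>x i. x ! i) A (1/3)"
    unfolding AMA_error_le_def
    by (intro exI[of _ 0])
      (auto simp: AMA_complete_def AMA_sound_def AMA_honest_output_def AMA_output_def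
        MA_honest_output_def MA_output_def A_def P_def c0 bind_return_pmf)
  moreover
  have "AMA_hcost ?X {..<n} A \<le> 1"
    unfolding AMA_hcost_def MA_hcost_def
    by (rule SUP_least, subst (2) add_0_right [symmetric], rule add_left_mono, rule SUP_least)
      (simp add: A_def P_def split_beta zero_enat_def)
  moreover have "AMA_vcost ?X A \<le> enat n"
    unfolding AMA_vcost_def MA_vcost_def
    by (auto simp: A_def P_def c0 sparse_inputs_def simp flip: zero_enat_def intro!: SUP_least)
  ultimately have err: "AMA_error_le ?X {..<n} (\<lambda>x i. x ! i) A (1/3)"
    and "AMA_hcost ?X {..<n} A + AMA_vcost ?X A \<le> 1 + enat n"
    by (auto intro: add_mono)
  then obtain k where "AMA_hcost ?X {..<n} A + AMA_vcost ?X A = enat k"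
    by (cases "AMA_hcost ?X {..<n} A + AMA_vcost ?X A") (auto simp: one_enat_def)
  with err have "\<exists>k A. AMA_error_le ?X {..<n} (\<lambda>x i. x ! i) A (1/3) \<and>
      AMA_hcost ?X {..<n} A + AMA_vcost ?X A = enat k"
    by blast
  from LeastI_ex[OF this] that show thesis
    unfolding sparse_index_complexity_def AMA_complexity_def by blast
qed

end

theory Submission
  imports Defs "HOL-Real_Asymp.Real_Asymp"
begin

text \<open>
  For the first \<open>m\<close> coordinates sparsity is no restriction, so already dense indexing on \<open>m\<close>
  positions is hard, even with free initial coins. Fix initial coins that work well for uniform
  \<open>x \<in> {0,1}\<^sup>m\<close> and \<open>i\<close>, and let Alice send about \<open>hcost\<close> independent copies of her message.
  Bob's empirical acceptance rate, maximised over all short help messages, is then close to the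
  true optimum and depends on \<open>x\<close> only through about \<open>hcost * vcost\<close> bits. It correlates with \<open>x\<close>
  on a constant fraction of the coordinates, whereas the maximal correlation of a random sign
  vector with one of \<open>2\<^sup>B\<close> fixed vectors in the unit cube is \<open>O(sqrt (m * B))\<close>. Hence
  \<open>hcost * vcost\<close> is of order at least \<open>m\<close>. One exponential-moment inequality serves both for the
  empirical rates and for the sign vectors.
\<close>

section \<open>Means over finite sets\<close>

text \<open>Expectation under the uniform distribution. Division by zero gives the value 0 on empty
  and infinite sets, so linearity and monotonicity hold unconditionally, while the mean of a
  constant requires a finite nonempty set.\<close>

definition mean :: "'a set \<Rightarrow> ('a \<Rightarrow> real) \<Rightarrow> real" where
  "mean A f = (\<Sum>a\<in>A. f a) / real (card A)"

lemma mean_cong: "(\<And>a. a \<in> A \<Longrightarrow> f a = g a) \<Longrightarrow> mean A f = mean A g"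
  by (simp add: mean_def)

lemma mean_mono: "(\<And>a. a \<in> A \<Longrightarrow> f a \<le> g a) \<Longrightarrow> mean A f \<le> mean A g"
  by (simp add: mean_def divide_right_mono sum_mono)

lemma mean_add: "mean A (\<lambda>a. f a + g a) = mean A f + mean A g"
  by (simp add: mean_def sum.distrib add_divide_distrib)

lemma mean_diff: "mean A (\<lambda>a. f a - g a) = mean A f - mean A g"
  by (simp add: mean_def sum_subtractf diff_divide_distrib)

lemma mean_cmult: "mean A (\<lambda>a. c * f a) = c * mean A f"
  by (simp add: mean_def flip: sum_distrib_left)

lemma mean_const: "finite A \<Longrightarrow> A \<noteq> {} \<Longrightarrow> mean A (\<lambda>_. c) = c"
  by (simp add: mean_def)

lemma mean_sum: "mean A (\<lambda>a. \<Sum>i\<in>I. f i a) = (\<Sum>i\<in>I. mean A (f i))"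
  by (simp add: mean_def sum.swap[of _ I] flip: sum_divide_distrib)

lemma mean_swap: "mean A (\<lambda>a. mean B (f a)) = mean B (\<lambda>b. mean A (\<lambda>a. f a b))"
  by (simp add: mean_def sum.swap[of _ B] mult.commute flip: sum_divide_distrib)

lemma mean_in_unit:
  assumes "\<And>a. a \<in> A \<Longrightarrow> 0 \<le> f a \<and> f a \<le> 1"
  shows "0 \<le> mean A f \<and> mean A f \<le> 1"
proof -
  have "0 \<le> (\<Sum>a\<in>A. f a)" "(\<Sum>a\<in>A. f a) \<le> real (card A)"
    using assms sum_bounded_above[of A f 1] by (auto intro: sum_nonneg)
  then show ?thesis by (auto simp: mean_def divide_le_eq)
qed

lemma ex_mean_le:
  assumes "finite A" "A \<noteq> {}"
  obtains a where "a \<in> A" "mean A f \<le> f a"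
proof (rule ccontr)
  assume "\<not> thesis"
  with that have "\<And>a. a \<in> A \<Longrightarrow> f a < mean A f" by force
  with assms have "(\<Sum>a\<in>A. f a) < (\<Sum>a\<in>A. mean A f)" by (intro sum_strict_mono) auto
  also have "\<dots> = (\<Sum>a\<in>A. f a)" using assms by (simp add: mean_def)
  finally show False by simp
qed

text \<open>Independence of the coordinates of a uniform point of a power of \<open>R\<close>:
  multiplying out a product of sums gives a sum over the product set, and the cardinalities multiply
  likewise.\<close>

lemma mean_prod_PiE:
  assumes "finite J" "finite R"
  shows "mean (PiE J (\<lambda>_. R)) (\<lambda>\<omega>. \<Prod>j\<in>J. f j (\<omega> j)) = (\<Prod>j\<in>J. mean R (f j))"
  using assms by (simp add: mean_def prod_sum_PiE[symmetric] card_PiE prod_dividef)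

lemma mean_PiE_component:
  assumes "finite J" "finite R" "R \<noteq> {}" "i \<in> J"
  shows "mean (PiE J (\<lambda>_. R)) (\<lambda>\<omega>. f (\<omega> i)) = mean R f"
proof -
  \<comment> \<open>Factors equal to 1 at the other coordinates turn the one-coordinate function
    into a product, so independence applies.\<close>
  have "mean (PiE J (\<lambda>_. R)) (\<lambda>\<omega>. f (\<omega> i))
      = mean (PiE J (\<lambda>_. R)) (\<lambda>\<omega>. \<Prod>j\<in>J. if j = i then f (\<omega> j) else 1)"
    using assms by (intro mean_cong) simp
  also have "\<dots> = (\<Prod>j\<in>J. mean R (\<lambda>r. if j = i then f r else 1))"
    using assms by (intro mean_prod_PiE)
  also have "\<dots> = (\<Prod>j\<in>J. if j = i then mean R f else 1)"
    using assms by (intro prod.cong) (auto simp: mean_const)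
  finally show ?thesis using assms by simp
qed

section \<open>A maximal inequality\<close>

lemma exp_bound_abs:
  fixes t :: real
  assumes "\<bar>t\<bar> \<le> 1"
  shows "exp t \<le> 1 + t + t\<^sup>2"
proof (cases "t \<ge> 0")
  case True
  with assms show ?thesis by (intro exp_bound) auto
next
  case False
  define s where "s = - t"
  have s: "0 \<le> s" using False by (simp add: s_def)
  \<comment> \<open>The claim amounts to \<open>1 \<le> (1 - s + s\<^sup>2) * exp s\<close>. When
    \<open>exp s\<close> is replaced by its quadratic Taylor polynomial, the linear terms cancel and
    the remaining coefficients are nonnegative.\<close>
  have "1 \<le> 1 + s\<^sup>2 / 2 + s ^ 3 / 2 + s ^ 4 / 2" using s by simp
  also have "\<dots> = (1 - s + s\<^sup>2) * (1 + s + s\<^sup>2 / 2)"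
    by (simp add: field_simps power2_eq_square power3_eq_cube power4_eq_xxxx)
  also have "\<dots> \<le> (1 - s + s\<^sup>2) * exp s"
  proof (rule mult_left_mono)
    show "1 + s + s\<^sup>2 / 2 \<le> exp s" using s by (rule exp_lower_Taylor_quadratic)
    show "0 \<le> 1 - s + s\<^sup>2" using assms False by (simp add: s_def)
  qed
  finally have "exp (- s) \<le> 1 - s + s\<^sup>2" by (simp add: exp_minus inverse_eq_divide divide_le_eq)
  then show ?thesis by (simp add: s_def)
qed

text \<open>A second-order bound on the moment generating function: centring removes the linear
  term, so only \<open>l\<^sup>2\<close> survives in the exponent.\<close>

lemma mean_exp_le:
  assumes R: "finite R" "R \<noteq> {}" and Y: "\<And>r. r \<in> R \<Longrightarrow> \<bar>Y r\<bar> \<le> 1" "mean R Y = 0"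
    and l: "0 \<le> l" "l \<le> 1"
  shows "mean R (\<lambda>r. exp (l * Y r)) \<le> exp (l\<^sup>2)"
proof -
  have "mean R (\<lambda>r. exp (l * Y r)) \<le> mean R (\<lambda>r. (1 + l\<^sup>2) + l * Y r)"
  proof (rule mean_mono)
    fix r assume r: "r \<in> R"
    have "\<bar>l * Y r\<bar> \<le> 1" using Y(1)[OF r] l by (simp add: abs_mult mult_le_one)
    then have "exp (l * Y r) \<le> 1 + l * Y r + (l * Y r)\<^sup>2" by (rule exp_bound_abs)
    moreover have "(l * Y r)\<^sup>2 \<le> l\<^sup>2"
      using Y(1)[OF r] by (simp add: power_mult_distrib mult_left_le abs_square_le_1)
    ultimately show "exp (l * Y r) \<le> (1 + l\<^sup>2) + l * Y r" by simp
  qed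
  also have "\<dots> = 1 + l\<^sup>2"
    by (simp only: mean_add mean_cmult mean_const[OF R] Y(2) mult_zero_right add_0_right)
  also have "\<dots> \<le> exp (l\<^sup>2)" by (rule exp_ge_add_one_self)
  finally show ?thesis .
qed

text \<open>
  Since \<open>s\<close> is arbitrary, this bounds the mean of the maximum over \<open>I\<close> of sums of independent
  centred variables.
\<close>

lemma mean_selected_sum_le:
  fixes Y :: "'i \<Rightarrow> 'j \<Rightarrow> 'r \<Rightarrow> real"
  assumes J: "finite J" and R: "finite R" "R \<noteq> {}" and I: "finite I" "real (card I) \<le> exp B"
    and Y: "\<And>i j r. i \<in> I \<Longrightarrow> j \<in> J \<Longrightarrow> r \<in> R \<Longrightarrow> \<bar>Y i j r\<bar> \<le> 1"
      "\<And>i j. i \<in> I \<Longrightarrow> j \<in> J \<Longrightarrow> mean R (Y i j) = 0"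
    and s: "\<And>\<omega>. \<omega> \<in> PiE J (\<lambda>_. R) \<Longrightarrow> s \<omega> \<in> I"
    and l: "0 < l" "l \<le> 1"
  shows "mean (PiE J (\<lambda>_. R)) (\<lambda>\<omega>. \<Sum>j\<in>J. Y (s \<omega>) j (\<omega> j)) \<le> B / l + l * card J"
proof -
  let ?\<Omega> = "PiE J (\<lambda>_. R)"
  define Z where "Z i \<omega> = (\<Sum>j\<in>J. Y i j (\<omega> j))" for i \<omega>
  define A where "A = B + l\<^sup>2 * card J"
  have \<Omega>: "finite ?\<Omega>" "?\<Omega> \<noteq> {}"
    using J R by (auto intro: finite_PiE simp: PiE_eq_empty_iff)
  have "exp (l * Z i \<omega>) = (\<Prod>j\<in>J. exp (l * Y i j (\<omega> j)))" for i \<omega>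
    by (simp add: Z_def sum_distrib_left exp_sum J)
  \<comment> \<open>For fixed \<open>i\<close> the exponential of the sum is a product over
    independent coordinates, so its mean factors; summing over \<open>I\<close> acts as the union
    bound.\<close>
  then have "mean ?\<Omega> (\<lambda>\<omega>. \<Sum>i\<in>I. exp (l * Z i \<omega>))
      = (\<Sum>i\<in>I. \<Prod>j\<in>J. mean R (\<lambda>r. exp (l * Y i j r)))"
    using mean_prod_PiE[OF J R(1), of "\<lambda>j r. exp (l * Y _ j r)"] by (simp only: mean_sum)
  also have "\<dots> \<le> (\<Sum>i\<in>I. \<Prod>j\<in>J. exp (l\<^sup>2))"
    using Y l R by (intro sum_mono prod_mono conjI mean_exp_le) (auto simp: mean_def sum_nonneg)
  also have "\<dots> = card I * exp (l\<^sup>2 * card J)"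
    by (simp add: exp_of_nat2_mult)
  also have "\<dots> \<le> exp B * exp (l\<^sup>2 * card J)"
    using I by (intro mult_right_mono) auto
  finally have E: "mean ?\<Omega> (\<lambda>\<omega>. \<Sum>i\<in>I. exp (l * Z i \<omega>)) \<le> exp A"
    by (simp add: A_def exp_add)
  \<comment> \<open>In place of Jensen's inequality, the tangent bound
    \<open>1 + u \<le> exp u\<close> is used at \<open>u = l * Z (s \<omega>) \<omega> - A\<close>.
    The factor \<open>exp (- A)\<close> makes the mean of the right side at most 1.\<close>
  have "l * mean ?\<Omega> (\<lambda>\<omega>. Z (s \<omega>) \<omega>) - A + 1 = mean ?\<Omega> (\<lambda>\<omega>. l * Z (s \<omega>) \<omega> - A + 1)"
    by (simp only: mean_add mean_diff mean_cmult mean_const[OF \<Omega>])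
  also have "\<dots> \<le> mean ?\<Omega> (\<lambda>\<omega>. exp (- A) * (\<Sum>i\<in>I. exp (l * Z i \<omega>)))"
  proof (rule mean_mono)
    fix \<omega> assume \<omega>: "\<omega> \<in> ?\<Omega>"
    have "l * Z (s \<omega>) \<omega> - A + 1 \<le> exp (l * Z (s \<omega>) \<omega> - A)"
      using exp_ge_add_one_self[of "l * Z (s \<omega>) \<omega> - A"] by linarith
    also have "\<dots> = exp (- A) * exp (l * Z (s \<omega>) \<omega>)"
      by (simp flip: exp_add)
    \<comment> \<open>The selected term is one of the nonnegative terms of the sum over
      \<open>I\<close>, which removes the dependence on \<open>s\<close>.\<close>
    also have "\<dots> \<le> exp (- A) * (\<Sum>i\<in>I. exp (l * Z i \<omega>))"
      using s[OF \<omega>] I by (intro mult_left_mono member_le_sum) auto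
    finally show "l * Z (s \<omega>) \<omega> - A + 1 \<le> exp (- A) * (\<Sum>i\<in>I. exp (l * Z i \<omega>))" .
  qed
  also have "\<dots> \<le> exp (- A) * exp A"
    unfolding mean_cmult using E by (intro mult_left_mono) auto
  also have "\<dots> = 1" by (simp flip: exp_add)
  finally have "l * mean ?\<Omega> (\<lambda>\<omega>. Z (s \<omega>) \<omega>) \<le> A" by simp
  with l have "mean ?\<Omega> (\<lambda>\<omega>. Z (s \<omega>) \<omega>) \<le> A / l" by (simp add: field_simps)
  also have "A / l = B / l + l * card J"
    using l by (simp add: A_def field_simps power2_eq_square)
  finally show ?thesis by (simp add: Z_def)
qed

lemma Max_image_attained:
  fixes f :: "'a \<Rightarrow> 'b :: linorder"
  assumes "finite A" "A \<noteq> {}"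
  shows "\<exists>a\<in>A. (MAX a\<in>A. f a) = f a"
proof -
  have "(MAX a\<in>A. f a) \<in> f ` A" using assms by (intro Max_in) auto
  then show ?thesis by auto
qed

text \<open>A uniform law of large numbers over \<open>L\<close>: a sample size proportional to
  \<open>B\<close> suffices. The empirical maximiser depends on the sample, so an overshoot needs
  the maximal inequality with a selection; an undershoot is controlled by a fixed true
  maximiser.\<close>

lemma mean_Max_empirical:
  fixes b :: "'h \<Rightarrow> 'r \<Rightarrow> real"
  assumes R: "finite R" "R \<noteq> {}" and L: "finite L" "L \<noteq> {}" "real (card L) \<le> exp B"
    and b: "\<And>h r. h \<in> L \<Longrightarrow> r \<in> R \<Longrightarrow> 0 \<le> b h r \<and> b h r \<le> 1"
    and k: "0 < k" "576 * B \<le> real k"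
  shows "\<bar>mean (PiE {..<k} (\<lambda>_. R)) (\<lambda>\<omega>. MAX h\<in>L. mean {..<k} (\<lambda>j. b h (\<omega> j)))
      - (MAX h\<in>L. mean R (b h))\<bar> \<le> 1/12"
proof -
  let ?\<Omega> = "PiE {..<k} (\<lambda>_. R)"
  define F where "F \<omega> h = mean {..<k} (\<lambda>j. b h (\<omega> j))" for \<omega> h
  define p where "p h = mean R (b h)" for h
  have \<Omega>: "finite ?\<Omega>" "?\<Omega> \<noteq> {}"
    using R by (auto intro: finite_PiE simp: PiE_eq_empty_iff)
  have p: "0 \<le> p h \<and> p h \<le> 1" if "h \<in> L" for h
    unfolding p_def using b that by (intro mean_in_unit) auto
  have dev: "mean ?\<Omega> (\<lambda>\<omega>. \<sigma> * (F \<omega> (s \<omega>) - p (s \<omega>))) \<le> 1/12"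
    if s: "\<And>\<omega>. \<omega> \<in> ?\<Omega> \<Longrightarrow> s \<omega> \<in> L" and \<sigma>: "\<bar>\<sigma>\<bar> = 1" for s and \<sigma> :: real
  proof -
    \<comment> \<open>The choice \<open>l = 1/24\<close> gives \<open>24 * B + k / 24\<close>; since
      \<open>576 = 24 * 24\<close>, each summand is at most \<open>k / 24\<close>, and division by
      \<open>k\<close> leaves 1/12. The sign \<open>\<sigma>\<close> covers both directions of
      deviation.\<close>
    have "mean ?\<Omega> (\<lambda>\<omega>. \<Sum>j<k. \<sigma> * (b (s \<omega>) (\<omega> j) - p (s \<omega>))) \<le> B / (1/24) + 1/24 * card {..<k}"
    proof (rule mean_selected_sum_le)
      show "\<bar>\<sigma> * (b h r - p h)\<bar> \<le> 1" if "h \<in> L" "r \<in> R" for h r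
        using p[OF that(1)] b[OF that] \<sigma> by (auto simp: abs_mult abs_le_iff)
      show "mean R (\<lambda>r. \<sigma> * (b h r - p h)) = 0" for h
        by (simp add: mean_cmult mean_diff mean_const[OF R] p_def)
    qed (use R L s in auto)
    moreover have "(\<Sum>j<k. \<sigma> * (b h (\<omega> j) - p h)) = k * (\<sigma> * (F \<omega> h - p h))" for h \<omega>
      using k by (simp add: F_def mean_def sum_subtractf field_simps flip: sum_distrib_left)
    ultimately have "k * mean ?\<Omega> (\<lambda>\<omega>. \<sigma> * (F \<omega> (s \<omega>) - p (s \<omega>))) \<le> 24 * B + k / 24"
      by (simp add: mean_cmult)
    also have "\<dots> \<le> k * (1/12)" using k by simp
    finally show ?thesis using k by simp
  qed
  have "\<exists>s. \<forall>\<omega>. s \<omega> \<in> L \<and> (MAX h\<in>L. F \<omega> h) = F \<omega> (s \<omega>)"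
    using Max_image_attained[OF L(1,2), of "F _"] by (intro choice allI) blast
  then obtain s where s: "\<And>\<omega>. s \<omega> \<in> L" "\<And>\<omega>. (MAX h\<in>L. F \<omega> h) = F \<omega> (s \<omega>)" by blast
  obtain h where h: "h \<in> L" "(MAX h\<in>L. p h) = p h"
    using Max_image_attained[OF L(1,2), of p] by blast
  have le_Max: "f h' \<le> (MAX h\<in>L. f h)" if "h' \<in> L" for h' and f :: "'h \<Rightarrow> real"
    using L that by simp
  have "mean ?\<Omega> (\<lambda>\<omega>. (MAX h\<in>L. F \<omega> h) - (MAX h\<in>L. p h))
      \<le> mean ?\<Omega> (\<lambda>\<omega>. 1 * (F \<omega> (s \<omega>) - p (s \<omega>)))"
    using s le_Max[of _ p] by (intro mean_mono) (simp add: s)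
  also have "\<dots> \<le> 1/12" using s by (intro dev) auto
  finally have 1: "mean ?\<Omega> (\<lambda>\<omega>. MAX h\<in>L. F \<omega> h) - (MAX h\<in>L. p h) \<le> 1/12"
    by (simp add: mean_diff mean_const[OF \<Omega>])
  have "mean ?\<Omega> (\<lambda>\<omega>. (MAX h\<in>L. p h) - (MAX h\<in>L. F \<omega> h)) \<le> mean ?\<Omega> (\<lambda>\<omega>. (-1) * (F \<omega> h - p h))"
    using h le_Max[of h "F _"] by (intro mean_mono) simp
  also have "\<dots> \<le> 1/12" using h by (intro dev) auto
  finally have 2: "(MAX h\<in>L. p h) - mean ?\<Omega> (\<lambda>\<omega>. MAX h\<in>L. F \<omega> h) \<le> 1/12"
    by (simp add: mean_diff mean_const[OF \<Omega>])
  from 1 2 show ?thesis unfolding F_def p_def by linarith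
qed

section \<open>One-way communication with nondeterministic help\<close>

text \<open>The values 1 and -1 give a uniform bit mean zero, as the maximal inequality
  requires.\<close>

definition bool_sign :: "bool \<Rightarrow> real" where
  "bool_sign b = (if b then 1 else - 1)"

text \<open>\<open>b i h r t\<close> is Bob's verdict on index \<open>i\<close> with help
  \<open>h\<close>, public string \<open>r\<close> and message \<open>t\<close>; Alice's help is
  absorbed into \<open>a\<close>. Once the samples are fixed, the empirical version of Bob's optimum
  is determined by \<open>k\<close> messages, so it ranges over at most \<open>exp (k * V)\<close>
  vectors, too few to correlate with a random sign vector unless \<open>k * V\<close> is
  large.\<close>

lemma one_way_index_bound:
  fixes a :: "(nat \<Rightarrow> bool) \<Rightarrow> 'r \<Rightarrow> 't" and b :: "nat \<Rightarrow> 'h \<Rightarrow> 'r \<Rightarrow> 't \<Rightarrow> bool"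
  assumes R: "finite R" "R \<noteq> {}" and L: "finite L" "L \<noteq> {}" "real (card L) \<le> exp B"
    and T: "finite T" "real (card T) \<le> exp V"
    and a: "\<And>x r. x \<in> X \<Longrightarrow> r \<in> R \<Longrightarrow> a x r \<in> T"
    and X: "X = PiE {..<N} (\<lambda>_. UNIV)"
    and k: "0 < k" "576 * B \<le> real k"
    and adv: "real N / 6 \<le> mean X (\<lambda>x. \<Sum>i<N. bool_sign (x i) *
        (MAX h\<in>L. mean R (\<lambda>r. of_bool (b i h r (a x r)))))"
  shows "real N \<le> 576 * real k * V"
proof -
  let ?\<Omega> = "PiE {..<k} (\<lambda>_. R)"
  define G where "G x i = (MAX h\<in>L. mean R (\<lambda>r. of_bool (b i h r (a x r))))" for x i
  define F :: "(nat \<Rightarrow> 't) \<Rightarrow> (nat \<Rightarrow> 'r) \<Rightarrow> nat \<Rightarrow> real"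
    where "F M \<omega> i = (MAX h\<in>L. mean {..<k} (\<lambda>j. of_bool (b i h (\<omega> j) (M j))))" for M \<omega> i
  \<comment> \<open>Restricting to the \<open>k\<close> sample positions places the message tuple in
    a finite set that can be counted.\<close>
  define M where "M \<omega> x = restrict (\<lambda>j. a x (\<omega> j)) {..<k}" for \<omega> x
  have \<Omega>: "finite ?\<Omega>" "?\<Omega> \<noteq> {}"
    using R by (auto intro: finite_PiE simp: PiE_eq_empty_iff)
  have finX: "finite X" "X \<noteq> {}"
    unfolding X by (auto intro: finite_PiE simp: PiE_eq_empty_iff)
  have emp: "\<bar>mean ?\<Omega> (\<lambda>\<omega>. F (M \<omega> x) \<omega> i) - G x i\<bar> \<le> 1/12" for x i
  proof -
    have "F (M \<omega> x) \<omega> i = (MAX h\<in>L. mean {..<k} (\<lambda>j. of_bool (b i h (\<omega> j) (a x (\<omega> j)))))" for \<omega>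
      unfolding F_def by (intro arg_cong[where f = Max] image_cong refl mean_cong) (simp add: M_def)
    then show ?thesis
      unfolding G_def using mean_Max_empirical[OF R L _ k, of "\<lambda>h r. of_bool (b i h r (a x r))"] by simp
  qed
  have "real N / 6 \<le> mean X (\<lambda>x. \<Sum>i<N. bool_sign (x i) * G x i)"
    using adv by (simp add: G_def)
  \<comment> \<open>Passing from \<open>G\<close> to the mean of \<open>F\<close> costs at most 1/12
    per coordinate, half of the assumed advantage.\<close>
  also have "\<dots> \<le> mean X (\<lambda>x. \<Sum>i<N. bool_sign (x i) * mean ?\<Omega> (\<lambda>\<omega>. F (M \<omega> x) \<omega> i) + 1/12)"
  proof (intro mean_mono sum_mono)
    fix x i
    show "bool_sign (x i) * G x i \<le> bool_sign (x i) * mean ?\<Omega> (\<lambda>\<omega>. F (M \<omega> x) \<omega> i) + 1/12"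
      using abs_le_D1[OF emp[of x i]] abs_le_D2[OF emp[of x i]]
      by (cases "x i") (simp_all add: bool_sign_def)
  qed
  also have "\<dots> = mean X (\<lambda>x. mean ?\<Omega> (\<lambda>\<omega>. \<Sum>i<N. bool_sign (x i) * F (M \<omega> x) \<omega> i)) + N / 12"
    by (simp add: sum.distrib mean_add mean_const[OF finX] mean_sum mean_cmult)
  also have "\<dots> = mean ?\<Omega> (\<lambda>\<omega>. mean X (\<lambda>x. \<Sum>i<N. bool_sign (x i) * F (M \<omega> x) \<omega> i)) + N / 12"
    by (subst mean_swap) (rule refl)
  finally have lb: "real N / 12 \<le> mean ?\<Omega> (\<lambda>\<omega>. mean X (\<lambda>x. \<Sum>i<N. bool_sign (x i) * F (M \<omega> x) \<omega> i))"
    by simp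
  \<comment> \<open>The samples are fixed independently of \<open>x\<close>, so the family of
    candidate vectors is the same for all \<open>x\<close>.\<close>
  obtain \<omega> where \<omega>: "\<omega> \<in> ?\<Omega>"
    and "mean ?\<Omega> (\<lambda>\<omega>. mean X (\<lambda>x. \<Sum>i<N. bool_sign (x i) * F (M \<omega> x) \<omega> i))
      \<le> mean X (\<lambda>x. \<Sum>i<N. bool_sign (x i) * F (M \<omega> x) \<omega> i)"
    using ex_mean_le[OF \<Omega>] by blast
  with lb have "real N / 12 \<le> mean X (\<lambda>x. \<Sum>i<N. bool_sign (x i) * F (M \<omega> x) \<omega> i)" by simp
  also have "\<dots> = mean (PiE {..<N} (\<lambda>_. UNIV)) (\<lambda>x. \<Sum>i<N. F (M \<omega> x) \<omega> i * bool_sign (x i))"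
    by (simp add: X mult.commute)
  \<comment> \<open>Second use of the maximal inequality: the bits of \<open>x\<close> are now the
    independent coordinates and the message tuple is the selected index. With
    \<open>l = 1/24\<close> the bound is \<open>24 * k * V + N / 24\<close>; comparison with
    \<open>N / 12\<close> gives the factor 576.\<close>
  also have "\<dots> \<le> k * V / (1/24) + 1/24 * card {..<N}"
  proof (rule mean_selected_sum_le[where I = "PiE {..<k} (\<lambda>_. T)"])
    have "real (card T) ^ k \<le> exp V ^ k" using T by (intro power_mono) auto
    then show "real (card (PiE {..<k} (\<lambda>_. T))) \<le> exp (k * V)"
      by (simp add: card_PiE exp_of_nat_mult)
    show "\<bar>F m \<omega> i * bool_sign c\<bar> \<le> 1" for m i c
    proof -
      obtain h where "F m \<omega> i = mean {..<k} (\<lambda>j. of_bool (b i h (\<omega> j) (m j)))"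
        unfolding F_def
        using Max_image_attained[OF L(1,2), of "\<lambda>h. mean {..<k} (\<lambda>j. of_bool (b i h (\<omega> j) (m j)))"]
        by blast
      then have "0 \<le> F m \<omega> i \<and> F m \<omega> i \<le> 1" by (auto intro!: mean_in_unit)
      then show ?thesis by (simp add: bool_sign_def abs_mult)
    qed
    show "mean UNIV (\<lambda>c. F m \<omega> i * bool_sign c) = 0" for m i
      by (simp add: mean_cmult) (simp add: mean_def bool_sign_def UNIV_bool)
    show "M \<omega> x \<in> PiE {..<k} (\<lambda>_. T)" if "x \<in> PiE {..<N} (\<lambda>_. UNIV)" for x
      using that \<omega> a unfolding M_def X by (auto simp: PiE_iff)
  qed (use T in \<open>auto intro: finite_PiE\<close>)
  finally show ?thesis by simp
qed

section \<open>The lower bound for sparse indexing\<close>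

lemma coin_strings: "finite {r :: bool list. length r = l}" "{r :: bool list. length r = l} \<noteq> {}"
proof -
  show "finite {r :: bool list. length r = l}"
    using finite_lists_length_eq[of "UNIV :: bool set" l] by simp
  have "replicate l True \<in> {r. length r = l}" by simp
  then show "{r :: bool list. length r = l} \<noteq> {}" by blast
qed

lemma set_pmf_coins [simp]: "set_pmf (coins l) = {r. length r = l}"
  unfolding coins_def by (intro set_pmf_of_set coin_strings)

lemma pmf_bind_coins: "pmf (bind_pmf (coins l) f) b = mean {r. length r = l} (\<lambda>r. pmf (f r) b)"
  unfolding coins_def mean_def by (intro pmf_bind_pmf_of_set coin_strings)

text \<open>The count is put in the form \<open>exp B\<close> because the maximal inequality
  measures families of help strings and messages in this way; the step from powers of 2 uses
  \<open>2 \<le> exp 1\<close>.\<close>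

lemma short_strings:
  "finite {s :: bool list. length s \<le> l}" "real (card {s :: bool list. length s \<le> l}) \<le> exp (real (l + 1))"
proof -
  show "finite {s :: bool list. length s \<le> l}"
    using finite_lists_length_le[of "UNIV :: bool set" l] by simp
  have "card {s :: bool list. length s \<le> l} = (\<Sum>i\<le>l. 2 ^ i)"
    using card_lists_length_le[of "UNIV :: bool set" l] by simp
  also have "\<dots> \<le> 2 ^ (l + 1)" by (induction l) auto
  finally have "real (card {s :: bool list. length s \<le> l}) \<le> real (2 ^ (l + 1))"
    by (simp only: of_nat_le_iff)
  also have "\<dots> = 2 ^ (l + 1)" by simp
  also have "\<dots> \<le> exp 1 ^ (l + 1)"
    using exp_ge_add_one_self[of 1] by (intro power_mono) auto
  also have "\<dots> = exp (real (l + 1))" by (simp only: exp_of_nat_mult[symmetric] mult_1_right)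
  finally show "real (card {s :: bool list. length s \<le> l}) \<le> exp (real (l + 1))" .
qed

lemma pmf_MA_output:
  "pmf (MA_output P x y h1 h2) True =
    mean {r. length r = public_coins P} (\<lambda>r. of_bool (bob P y h2 r (alice P x h1 r)))"
  unfolding MA_output_def map_pmf_def pmf_bind_coins
  by (intro mean_cong) (simp add: pmf_return)

lemma AMA_help2_length:
  assumes "AMA_hcost X Y A \<le> enat H" "length c = initial_coins A" "x \<in> X" "y \<in> Y"
    "length rM = merlin_coins (stage A c)"
  shows "length (help2 (stage A c) x y rM) \<le> H"
proof -
  let ?P = "stage A c"
  have "enat (length (help2 ?P x y rM)) \<le> enat (length (help1 ?P x rM) + length (help2 ?P x y rM))"
    by simp
  also have "\<dots> \<le> (SUP (x, y, rM) \<in> X \<times> Y \<times> set_pmf (coins (merlin_coins ?P)).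
            enat (length (help1 ?P x rM) + length (help2 ?P x y rM)))"
    using assms by (intro SUP_upper2[of "(x, y, rM)"]) auto
  also have "\<dots> \<le> MA_hcost X Y ?P" unfolding MA_hcost_def by simp
  also have "\<dots> \<le> AMA_hcost X Y A"
    unfolding AMA_hcost_def using assms by (intro SUP_upper) auto
  finally show ?thesis using assms(1) by (meson enat_ord_simps(1) order_trans)
qed

lemma AMA_alice_length:
  assumes "AMA_vcost X A \<le> enat V" "length c = initial_coins A" "x \<in> X"
    "length r = public_coins (stage A c)"
  shows "length (alice (stage A c) x h r) \<le> V"
proof -
  let ?P = "stage A c"
  have "enat (length (alice ?P x h r)) \<le> MA_vcost X ?P"
    unfolding MA_vcost_def using assms by (intro SUP_upper2[of "(x, h, r)"]) auto
  also have "\<dots> \<le> (SUP c \<in> set_pmf (coins (initial_coins A)). MA_vcost X (stage A c))"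
    using assms by (intro SUP_upper) auto
  also have "\<dots> \<le> AMA_vcost X A" unfolding AMA_vcost_def by simp
  finally show ?thesis using assms(1) by (meson enat_ord_simps(1) order_trans)
qed

text \<open>
  Alice's help may depend on Merlin's coins but not on Bob's index, so averaging yields, for each
  \<open>x\<close>, coins that serve all indices at once.
\<close>

lemma AMA_deterministic_help:
  assumes A: "AMA_error_le X Y F A (1/3)" and H: "AMA_hcost X Y A \<le> enat H"
    and x: "x \<in> X" and I: "finite I" "I \<subseteq> Y"
  obtains h1 where "(\<Sum>i\<in>I. if F x i then 2/3 else - 1/3) \<le>
    mean {c. length c = initial_coins A} (\<lambda>c. \<Sum>i\<in>I. bool_sign (F x i) *
      (MAX h\<in>{h. length h \<le> H}. pmf (MA_output (stage A c) x i (h1 c) h) True))"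
proof -
  let ?C = "{c :: bool list. length c = initial_coins A}"
  let ?L = "{h :: bool list. length h \<le> H}"
  let ?M = "\<lambda>c. {r :: bool list. length r = merlin_coins (stage A c)}"
  define acc where "acc c i h h' = pmf (MA_output (stage A c) x i h h') True" for c i h h'
  define q where "q c i r = acc c i (help1 (stage A c) x r) (help2 (stage A c) x i r)" for c i r
  define I1 where "I1 = {i\<in>I. F x i}"
  have complete: "2/3 \<le> mean ?C (\<lambda>c. mean (?M c) (q c i))" if "i \<in> I1" for i
  proof -
    have "pmf (AMA_honest_output A x i) False \<le> 1/3"
      using A x I that unfolding AMA_error_le_def AMA_complete_def I1_def by fastforce
    then have "2/3 \<le> pmf (AMA_honest_output A x i) True"
      by (simp add: pmf_False_conv_True)
    then show ?thesis
      by (simp add: AMA_honest_output_def MA_honest_output_def pmf_bind_coins q_def[abs_def] acc_def)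
  qed
  have sound: "mean ?C (\<lambda>c. acc c i (h1 c) (h2 c)) \<le> 1/3" if "i \<in> I" "\<not> F x i" for i h1 h2
  proof -
    from A obtain \<delta> where \<delta>: "AMA_sound X Y F A \<delta>" "\<delta> \<le> 1/3"
      unfolding AMA_error_le_def by auto
    then have "pmf (AMA_output A x i h1 h2) True \<le> \<delta>"
      using x I that unfolding AMA_sound_def by blast
    with \<delta>(2) have "pmf (AMA_output A x i h1 h2) True \<le> 1/3" by linarith
    then show ?thesis by (simp add: AMA_output_def pmf_bind_coins acc_def)
  qed
  have "\<exists>r. r \<in> ?M c \<and> mean (?M c) (\<lambda>r. \<Sum>i\<in>I1. q c i r) \<le> (\<Sum>i\<in>I1. q c i r)" for c
    by (rule ex_mean_le[OF coin_strings, of "merlin_coins (stage A c)" "\<lambda>r. \<Sum>i\<in>I1. q c i r"]) blast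
  then obtain \<rho> where \<rho>: "\<And>c. \<rho> c \<in> ?M c"
    "\<And>c. (\<Sum>i\<in>I1. mean (?M c) (q c i)) \<le> (\<Sum>i\<in>I1. q c i (\<rho> c))"
    unfolding mean_sum by metis
  define h1 where "h1 c = help1 (stage A c) x (\<rho> c)" for c
  define G where "G c i = (MAX h\<in>?L. acc c i (h1 c) h)" for c i
  have L: "finite ?L" "?L \<noteq> {}" using short_strings by (auto intro: exI[of _ "[]"])
  \<comment> \<open>The maximising help is itself a dishonest strategy: it may depend on
    \<open>c\<close>, since Merlin sees the initial coins, so soundness bounds the mean of the
    maximum.\<close>
  have zero: "mean ?C (\<lambda>c. G c i) \<le> 1/3" if "i \<in> I" "\<not> F x i" for i
  proof -
    have "\<exists>h. G c i = acc c i (h1 c) h" for c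
      using Max_image_attained[OF L, of "acc c i (h1 c)"] unfolding G_def by blast
    then obtain h2 where "\<And>c. G c i = acc c i (h1 c) (h2 c)" by metis
    then show ?thesis using sound[OF that, of h1 h2] by simp
  qed
  have one: "(\<Sum>i\<in>I1. 2/3) \<le> mean ?C (\<lambda>c. \<Sum>i\<in>I1. G c i)"
  proof -
    have "(\<Sum>i\<in>I1. 2/3) \<le> (\<Sum>i\<in>I1. mean ?C (\<lambda>c. mean (?M c) (q c i)))"
      using complete by (rule sum_mono)
    also have "\<dots> = mean ?C (\<lambda>c. \<Sum>i\<in>I1. mean (?M c) (q c i))"
      by (simp add: mean_sum)
    also have "\<dots> \<le> mean ?C (\<lambda>c. \<Sum>i\<in>I1. q c i (\<rho> c))"
      using \<rho> by (intro mean_mono)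
    also have "\<dots> \<le> mean ?C (\<lambda>c. \<Sum>i\<in>I1. G c i)"
    proof (intro mean_mono sum_mono)
      \<comment> \<open>The honest message to Bob has length at most \<open>H\<close>, so it is
        among the candidates of the maximum.\<close>
      fix c i assume "c \<in> ?C" "i \<in> I1"
      then have "help2 (stage A c) x i (\<rho> c) \<in> ?L"
        using AMA_help2_length[OF H _ x, of c i "\<rho> c"] \<rho>(1)[of c] I by (auto simp: I1_def)
      then show "q c i (\<rho> c) \<le> G c i"
        unfolding q_def G_def h1_def using L by (intro Max_ge) auto
    qed
    finally show ?thesis .
  qed
  have split: "(\<Sum>i\<in>I. f i) = (\<Sum>i\<in>I1. f i) + (\<Sum>i\<in>I - I1. f i)" for f :: "'b \<Rightarrow> real"
    using I by (simp add: sum.subset_diff[of I1 I] I1_def)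
  \<comment> \<open>Completeness contributes at least 2/3 for each index with answer 1, soundness at
    least -1/3 for each index with answer 0.\<close>
  have "(\<Sum>i\<in>I. if F x i then 2/3 else - 1/3) = (\<Sum>i\<in>I1. 2/3) + (\<Sum>i\<in>I - I1. - (1/3 :: real))"
    unfolding split by (intro arg_cong2[where f = "(+)"] sum.cong) (auto simp: I1_def)
  also have "\<dots> \<le> mean ?C (\<lambda>c. \<Sum>i\<in>I1. G c i) + (\<Sum>i\<in>I - I1. - mean ?C (\<lambda>c. G c i))"
    using one zero by (intro add_mono sum_mono) (auto simp: I1_def)
  also have "\<dots> = mean ?C (\<lambda>c. (\<Sum>i\<in>I1. G c i) - (\<Sum>i\<in>I - I1. G c i))"
    by (simp add: mean_diff mean_sum sum_negf)
  also have "\<dots> = mean ?C (\<lambda>c. \<Sum>i\<in>I. bool_sign (F x i) * G c i)"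
  proof (rule mean_cong)
    fix c
    have "(\<Sum>i\<in>I1. bool_sign (F x i) * G c i) = (\<Sum>i\<in>I1. G c i)"
      by (intro sum.cong) (auto simp: I1_def bool_sign_def)
    moreover have "(\<Sum>i\<in>I - I1. bool_sign (F x i) * G c i) = (\<Sum>i\<in>I - I1. - G c i)"
      by (intro sum.cong) (auto simp: I1_def bool_sign_def)
    ultimately show "(\<Sum>i\<in>I1. G c i) - (\<Sum>i\<in>I - I1. G c i) = (\<Sum>i\<in>I. bool_sign (F x i) * G c i)"
      unfolding split by (simp add: sum_negf)
  qed
  finally show thesis by (intro that[of h1]) (simp add: G_def acc_def)
qed

text \<open>Padding an arbitrary string of \<open>N\<close> bits with zeros keeps its weight at most
  \<open>N \<le> m\<close>, so the protocol solves unrestricted indexing on \<open>N\<close>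
  positions, to which the one-way bound applies.\<close>

lemma AMA_sparse_index_bound:
  assumes A: "AMA_error_le (sparse_inputs m n) {..<n} (\<lambda>x i. x ! i) A (1/3)"
    and H: "AMA_hcost (sparse_inputs m n) {..<n} A \<le> enat H"
    and V: "AMA_vcost (sparse_inputs m n) A \<le> enat V"
    and N: "N \<le> m" "N \<le> n"
  shows "real N \<le> 576\<^sup>2 * real (H + 1) * real (V + 1)"
proof -
  let ?X = "sparse_inputs m n" and ?C = "{c :: bool list. length c = initial_coins A}"
  let ?L = "{h :: bool list. length h \<le> H}"
  define X :: "(nat \<Rightarrow> bool) set" where "X = PiE {..<N} (\<lambda>_. UNIV)"
  define e :: "(nat \<Rightarrow> bool) \<Rightarrow> bool list"
    where "e x = map x [0..<N] @ replicate (n - N) False" for x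
  have e: "e x \<in> ?X" for x
  proof -
    have "count_list (e x) True \<le> N"
      using count_le_length[of "map x [0..<N]" True] by (simp add: e_def count_list_0_iff)
    then show ?thesis using N by (auto simp: sparse_inputs_def e_def)
  qed
  have e_nth: "e x ! i = x i" if "i < N" for x i
    using that by (simp add: e_def nth_append)
  have X: "finite X" "X \<noteq> {}"
    unfolding X_def by (auto intro: finite_PiE simp: PiE_eq_empty_iff)
  define G where "G x h1 c i = (MAX h\<in>?L. pmf (MA_output (stage A c) (e x) i (h1 c) h) True)"
    for x h1 c i
  have "\<exists>h1. (\<Sum>i<N. if x i then 2/3 else - 1/3) \<le> mean ?C (\<lambda>c. \<Sum>i<N. bool_sign (x i) * G x h1 c i)"
    for x
  proof -
    obtain h1 where "(\<Sum>i<N. if e x ! i then 2/3 else - 1/3) \<le>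
        mean ?C (\<lambda>c. \<Sum>i<N. bool_sign (e x ! i) * G x h1 c i)"
      unfolding G_def
      by (rule AMA_deterministic_help[OF A H e, of "{..<N}" x]) (use N in auto)
    moreover have "(\<Sum>i<N. if e x ! i then 2/3 else - 1/3 :: real) = (\<Sum>i<N. if x i then 2/3 else - 1/3)"
      by (intro sum.cong) (simp_all add: e_nth)
    moreover have "(\<Sum>i<N. bool_sign (e x ! i) * f i) = (\<Sum>i<N. bool_sign (x i) * f i)" for f
      by (intro sum.cong) (simp_all add: e_nth)
    ultimately show ?thesis by (intro exI[of _ h1]) simp
  qed
  then have "\<forall>x. \<exists>h1. (\<Sum>i<N. if x i then 2/3 else - 1/3) \<le>
      mean ?C (\<lambda>c. \<Sum>i<N. bool_sign (x i) * G x h1 c i)"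
    by (rule allI)
  from choice[OF this] obtain h1 where h1: "\<And>x. (\<Sum>i<N. if x i then 2/3 else - 1/3) \<le>
      mean ?C (\<lambda>c. \<Sum>i<N. bool_sign (x i) * G x (h1 x) c i)"
    by (elim exE) (rule that, erule allE)
  \<comment> \<open>For a uniform bit, 2/3 and -1/3 average to 1/6.\<close>
  have "real N / 6 = (\<Sum>i<N. mean UNIV (\<lambda>b. if b then 2/3 else - 1/3))"
    by (simp add: mean_def UNIV_bool)
  also have "\<dots> = (\<Sum>i<N. mean X (\<lambda>x. if x i then 2/3 else - 1/3))"
    unfolding X_def
  proof (rule sum.cong[OF refl])
    fix i assume "i \<in> {..<N}"
    then show "mean UNIV (\<lambda>b. if b then 2/3 else - 1/3)
        = mean (PiE {..<N} (\<lambda>_. UNIV)) (\<lambda>x. if x i then 2/3 else - 1/3)"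
      by (intro mean_PiE_component[where f = "\<lambda>b. if b then 2/3 else - 1/3", symmetric]) auto
  qed
  also have "\<dots> = mean X (\<lambda>x. \<Sum>i<N. if x i then 2/3 else - 1/3)"
    by (simp add: mean_sum)
  also have "\<dots> \<le> mean X (\<lambda>x. mean ?C (\<lambda>c. \<Sum>i<N. bool_sign (x i) * G x (h1 x) c i))"
    by (intro mean_mono h1)
  also have "\<dots> = mean ?C (\<lambda>c. mean X (\<lambda>x. \<Sum>i<N. bool_sign (x i) * G x (h1 x) c i))"
    by (rule mean_swap)
  finally have lb: "real N / 6 \<le> mean ?C (\<lambda>c. mean X (\<lambda>x. \<Sum>i<N. bool_sign (x i) * G x (h1 x) c i))" .
  \<comment> \<open>With the means swapped, a single outcome \<open>c\<close> of the initial coins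
    serves uniform \<open>x\<close>; from here on the protocol is an online MA protocol.\<close>
  obtain c where c: "c \<in> ?C" and
    "mean ?C (\<lambda>c. mean X (\<lambda>x. \<Sum>i<N. bool_sign (x i) * G x (h1 x) c i))
      \<le> mean X (\<lambda>x. \<Sum>i<N. bool_sign (x i) * G x (h1 x) c i)"
    using ex_mean_le[OF coin_strings] by blast
  with lb have adv: "real N / 6 \<le> mean X (\<lambda>x. \<Sum>i<N. bool_sign (x i) * G x (h1 x) c i)" by simp
  have L: "finite ?L" "?L \<noteq> {}" using short_strings by (auto intro: exI[of _ "[]"])
  \<comment> \<open>Strings of length at most \<open>H\<close> allow \<open>B = H + 1\<close>, so
    \<open>k = 576 * (H + 1)\<close> samples suffice; messages of length at most \<open>V\<close>
    contribute the exponent \<open>V + 1\<close>.\<close>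
  have "real N \<le> 576 * real (576 * (H + 1)) * real (V + 1)"
  proof (rule one_way_index_bound[where a = "\<lambda>x. alice (stage A c) (e x) (h1 x c)"
        and b = "bob (stage A c)", OF coin_strings L short_strings(2) short_strings _ X_def])
    show "alice (stage A c) (e x) (h1 x c) r \<in> {s. length s \<le> V}"
      if "r \<in> {r. length r = public_coins (stage A c)}" for x r
      using AMA_alice_length[OF V _ e] c that by simp
    show "real N / 6 \<le> mean X (\<lambda>x. \<Sum>i<N. bool_sign (x i) *
        (MAX h\<in>?L. mean {r. length r = public_coins (stage A c)}
          (\<lambda>r. of_bool (bob (stage A c) i h r (alice (stage A c) (e x) (h1 x c) r)))))"
      using adv by (simp add: G_def pmf_MA_output)
  qed auto
  then show ?thesis by (simp add: power2_eq_square)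
qed

section \<open>From the product of the costs to the asymptotic bound\<close>

lemma sqrt_le_sparse_index_complexity:
  assumes "m \<le> n"
  shows "sqrt (real m) \<le> 576 * (real (sparse_index_complexity m n) + 1)"
proof -
  let ?X = "sparse_inputs m n" and ?K = "sparse_index_complexity m n"
  obtain A where A: "AMA_error_le ?X {..<n} (\<lambda>x i. x ! i) A (1/3)"
    and K: "AMA_hcost ?X {..<n} A + AMA_vcost ?X A = enat ?K"
    by (rule sparse_index_complexity_attained)
  have "AMA_hcost ?X {..<n} A \<le> enat ?K" "AMA_vcost ?X A \<le> enat ?K"
    by (simp_all flip: K)
  \<comment> \<open>Each cost is at most their sum \<open>?K\<close>, so the product bound becomes a
    square.\<close>
  then have "real m \<le> 576\<^sup>2 * real (?K + 1) * real (?K + 1)"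
    by (intro AMA_sparse_index_bound[OF A]) (use assms in auto)
  also have "\<dots> = (576 * (real ?K + 1))\<^sup>2" by (simp add: power2_eq_square algebra_simps)
  finally show ?thesis by (intro real_le_lsqrt) auto
qed

theorem theoremA1:
  "\<exists>k::nat. (\<lambda>m::nat. real (sparse_index_complexity m (nat \<lfloor>2 powr sqrt (real m)\<rfloor>)))
     \<in> \<Omega>(\<lambda>m::nat. sqrt (real m) / ln (real m) ^ k)"
\<comment> \<open>The exponent 0 means that no logarithmic factor is lost. Once
  \<open>sqrt m\<close> is at least 1152, the summand 576 in \<open>576 * (K + 1)\<close> is at most
  half of \<open>sqrt m\<close>, which leaves \<open>K \<ge> sqrt m / 1152\<close>.\<close>
proof (intro exI[of _ 0] landau_omega.bigI[of "1/1152"])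
  \<comment> \<open>This makes the input length at least \<open>m\<close>, so all of the first
    \<open>m\<close> positions are available.\<close>
  have "\<forall>\<^sub>F m :: nat in sequentially. real m \<le> 2 powr sqrt (real m)"
    by real_asymp
  moreover have "\<forall>\<^sub>F m :: nat in sequentially. 1152 \<le> sqrt (real m)"
    by real_asymp
  ultimately show "\<forall>\<^sub>F m :: nat in sequentially.
      norm (real (sparse_index_complexity m (nat \<lfloor>2 powr sqrt (real m)\<rfloor>)))
        \<ge> 1/1152 * norm (sqrt (real m) / ln (real m) ^ 0)"
  proof eventually_elim
    case (elim m)
    then have "m \<le> nat \<lfloor>2 powr sqrt (real m)\<rfloor>" by (intro le_nat_floor)
    from sqrt_le_sparse_index_complexity[OF this] elim(2) show ?case by simp
  qed
qed simp

end
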